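(* Let $G$ be a finite simple graph without isolated vertices. Then the fractional domatic number of $G$ equals $2$ if and only if $G$ contains a vertex of degree one or has a connected component isomorphic to the $4$-cycle $C_4$.
   Context: A set $D\subseteq V(G)$ is dominating if every vertex not in $D$ has a neighbour in $D$. For positive integers $k,s$, a $(k,s)$-configuration of $G$ is a multiset of $k$ (not necessarily distinct) dominating sets of $G$ such that every vertex of $G$ belongs to at most $s$ of them. The fractional domatic number $FD(G)$ is the maximum of $k/s$ over all pairs $(k,s)$ for which $G$ admits a $(k,s)$-configuration (equivalently, the optimum of the LP relaxation of the domatic number integer program). *)

theory Defs
  imports "Graph_Theory.Graph_Theory" "HOL-Library.Multiset" "HOL-Library.Extended_Real"
begin

text \<open>
  As in the Graph Theory library, undirected graphs are symmetric digraphs: every edge is a pair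
  of opposite arcs.  In particular the degree of a vertex is its \<^const>\<open>out_degree\<close>.
\<close>

definition dominating_set :: "('a, 'b) pre_digraph \<Rightarrow> 'a set \<Rightarrow> bool" where
  "dominating_set G D \<longleftrightarrow>
     D \<subseteq> verts G \<and> (\<forall>v \<in> verts G - D. \<exists>u \<in> D. v \<rightarrow>\<^bsub>G\<^esub> u)"

definition configuration ::
  "('a, 'b) pre_digraph \<Rightarrow> nat \<Rightarrow> nat \<Rightarrow> 'a set multiset \<Rightarrow> bool" where
  "configuration G k s M \<longleftrightarrow>
     k > 0 \<and> s > 0 \<and> size M = k \<and> (\<forall>D \<in># M. dominating_set G D) \<and>
     (\<forall>v \<in> verts G. size {#D \<in># M. v \<in> D#} \<le> s)"

text \<open>
  The supremum is taken in the extended reals, so that it is \<open>\<infinity>\<close> for the graph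
  without vertices, where the ratios are unbounded.  For every other finite graph it is a maximum,
  see \<open>fractional_domatic_number_attained\<close> below.
\<close>

definition fractional_domatic_number :: "('a, 'b) pre_digraph \<Rightarrow> ereal" where
  "fractional_domatic_number G =
     Sup {ereal (real k / real s) | k s. \<exists>M. configuration G k s M}"

definition connected_components :: "('a, 'b) pre_digraph \<Rightarrow> ('a, 'b) pre_digraph set" where
  "connected_components G = {H. pre_digraph.max_subgraph G Digraph_Component.connected H}"

definition C4 :: "nat pair_pre_digraph" where
  "C4 = \<lparr> pverts = {0, 1, 2, 3},
          parcs = {(0,1), (1,0), (1,2), (2,1), (2,3), (3,2), (3,0), (0,3)} \<rparr>"

subsection \<open>The supremum is a maximum\<close>

lemma nat_seq_mono_subseq:
  fixes g :: "nat \<Rightarrow> nat"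
  shows "\<exists>r :: nat \<Rightarrow> nat. strict_mono r \<and> mono (\<lambda>n. g (r n))"
proof -
  obtain r :: "nat \<Rightarrow> nat" where r: "strict_mono r" "monoseq (\<lambda>n. g (r n))"
    using seq_monosub[of g] by blast
  show ?thesis
  proof (cases "\<forall>m. \<forall>n\<ge>m. g (r m) \<le> g (r n)")
    case True
    with r show ?thesis by (auto simp: mono_def)
  next
    case False
    with r have dec: "\<And>m n. m \<le> n \<Longrightarrow> g (r n) \<le> g (r m)"
      by (auto simp: monoseq_def)
    obtain N where N: "\<And>n. g (r N) \<le> g (r n)"
      using ex_has_least_nat[of "\<lambda>_. True" 0 "\<lambda>n. g (r n)"] by auto
    have "strict_mono (\<lambda>n. r (n + N))"
      using r(1) by (simp add: strict_mono_def)
    moreover have "g (r (n + N)) = g (r N)" for n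
      using dec[of N "n + N"] N[of "n + N"] by simp
    ultimately show ?thesis by (intro exI[of _ "\<lambda>n. r (n + N)"]) (simp add: mono_def)
  qed
qed

lemma dickson:
  fixes f :: "nat \<Rightarrow> 'i \<Rightarrow> nat"
  assumes "finite I"
  shows "\<exists>r :: nat \<Rightarrow> nat. strict_mono r \<and> (\<forall>x\<in>I. mono (\<lambda>n. f (r n) x))"
  using assms
proof (induction I)
  case empty
  show ?case by (intro exI[of _ id]) (simp add: strict_mono_def)
next
  case (insert x I)
  then obtain r :: "nat \<Rightarrow> nat" where r: "strict_mono r" "\<forall>y\<in>I. mono (\<lambda>n. f (r n) y)" by blast
  obtain q :: "nat \<Rightarrow> nat" where q: "strict_mono q" "mono (\<lambda>n. f (r (q n)) x)"
    using nat_seq_mono_subseq[of "\<lambda>n. f (r n) x"] by blast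
  have "strict_mono (\<lambda>n. r (q n))"
    using r(1) q(1) by (simp add: strict_mono_def)
  moreover have "mono (\<lambda>n. f (r (q n)) y)" if "y \<in> I" for y
    using r(2) q(1) that by (simp add: mono_def strict_mono_less_eq)
  ultimately show ?case using q(2) by blast
qed

lemma fractional_domatic_number_attained:
  assumes fin: "finite (verts G)" and ne: "verts G \<noteq> {}"
  shows "\<exists>k s M. configuration G k s M \<and>
           fractional_domatic_number G = ereal (real k / real s)"
proof -
  define V where "V = verts G"
  define conf where "conf = (\<lambda>(M, s). configuration G (size M) s M)"
  define ratio where "ratio = (\<lambda>(M :: 'a set multiset, s :: nat). real (size M) / real s)"
  define cov where "cov = (\<lambda>(M :: 'a set multiset) v. size {#D \<in># M. v \<in> D#})"
  have conf_iff: "conf (M, s) \<longleftrightarrow> size M > 0 \<and> s > 0 \<and> (\<forall>D \<in># M. dominating_set G D) \<and>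
      (\<forall>v \<in> V. cov M v \<le> s)" for M s
    by (simp add: conf_def configuration_def cov_def V_def)
  have dom_ne: "\<exists>v \<in> V. v \<in> D" if "dominating_set G D" for D
    using that ne by (auto simp: dominating_set_def V_def)
  have "\<exists>x. conf x \<and> (\<forall>y. conf y \<longrightarrow> ratio y \<le> ratio x)"
  proof (rule ccontr)
    assume "\<not> ?thesis"
    then have better: "\<exists>y. conf y \<and> ratio x < ratio y" if "conf x" for x
      using that by (meson not_le)
    have start: "conf ({#V#}, 1)"
      by (simp add: conf_iff cov_def dominating_set_def V_def)
    define step where "step = (\<lambda>x y. ratio x < ratio y \<and>
      (\<forall>z. conf z \<and> ratio x < ratio z \<longrightarrow> snd y \<le> snd z))"
    have "\<exists>y. conf y \<and> step x y" if "conf x" for x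
      using ex_has_least_nat[of "\<lambda>y. conf y \<and> ratio x < ratio y" _ snd] better[OF that]
      unfolding step_def by (metis (no_types, lifting))
    with start obtain x where conf: "\<And>n. conf (x n)" and step: "\<And>n. step (x n) (x (Suc n))"
      using dependent_nat_choice[of "\<lambda>_. conf" "\<lambda>_. step"] by metis
    have incr: "strict_mono (\<lambda>n. ratio (x n))"
      using step by (simp add: strict_mono_Suc_iff step_def)
    define f where "f = (\<lambda>n. case_sum (\<lambda>D. count (fst (x n)) D)
      (\<lambda>v. snd (x n) - cov (fst (x n)) v))"
    define f' where "f' = (\<lambda>n. case_option (snd (x n)) (f n))"
    have "finite (insert None (Some ` (Pow V <+> V)))"
      using fin by (simp add: V_def)
    from dickson[OF this, of f'] obtain r :: "nat \<Rightarrow> nat" where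
      r: "strict_mono r" "\<And>p. p \<in> insert None (Some ` (Pow V <+> V)) \<Longrightarrow> mono (\<lambda>n. f' (r n) p)"
      by blast
    define i j where "i = r 0" and "j = r 1"
    have "i < j" using r(1) by (simp add: i_def j_def strict_mono_def)
    have le: "f' i p \<le> f' j p" if "p \<in> insert None (Some ` (Pow V <+> V))" for p
      using monoD[OF r(2)[OF that], of 0 1] by (simp add: i_def j_def)
    obtain M s where Ms: "x i = (M, s)" by fastforce
    obtain N t where Nt: "x j = (N, t)" by fastforce
    have cM: "conf (M, s)" and cN: "conf (N, t)" using conf Ms Nt by metis+
    have ratios: "ratio (M, s) < ratio (N, t)"
      using incr \<open>i < j\<close> Ms Nt by (metis strict_mono_def)
    have st: "s \<le> t" using le[of None] by (simp add: f'_def Ms Nt)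
    have count: "count M D \<le> count N D" for D
    proof (cases "D \<in> Pow V")
      case True
      then show ?thesis using le[of "Some (Inl D)"] by (simp add: f'_def f_def Ms Nt InlI InrI)
    next
      case False
      then have "D \<notin># M" using cM by (auto simp: conf_iff dominating_set_def V_def)
      then show ?thesis by (simp add: not_in_iff)
    qed
    then have sub: "M \<subseteq># N" by (simp add: mset_subset_eqI)
    define L where "L = N - M"
    have N: "N = M + L" using sub by (simp add: L_def)
    have covN: "cov N v = cov M v + cov L v" for v by (simp add: N cov_def)
    have slack: "cov L v \<le> t - s" if "v \<in> V" for v
    proof -
      have "s - cov M v \<le> t - cov N v"
        using le[of "Some (Inr v)"] that by (simp add: f'_def f_def Ms Nt InlI InrI)
      moreover have "cov M v \<le> s" "cov N v \<le> t" using cM cN that by (auto simp: conf_iff)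
      ultimately show ?thesis using covN[of v] st by linarith
    qed
    have pos: "0 < s" "0 < t" "0 < size M" using cM cN by (auto simp: conf_iff)
    have Lne: "L \<noteq> {#}"
    proof
      assume "L = {#}"
      with ratios N have "real (size M) / real s < real (size M) / real t"
        by (simp add: ratio_def)
      moreover have "real (size M) / real t \<le> real (size M) / real s"
        using st pos by (intro divide_left_mono) auto
      ultimately show False by linarith
    qed
    then obtain D where D: "D \<in># L" by blast
    then have "dominating_set G D" using cN by (simp add: conf_iff N)
    then obtain v where v: "v \<in> V" "v \<in> D" using dom_ne by blast
    have "D \<in># {#D \<in># L. v \<in> D#}" using D v by simp
    then have "0 < cov L v" unfolding cov_def by (metis empty_iff nonempty_has_size set_mset_empty)
    with slack[OF v(1)] have lt: "s < t" by linarith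
    have cL: "conf (L, t - s)"
      using Lne lt slack cN by (auto simp: conf_iff N nonempty_has_size)
    have "real (size M) * real t < real (size M + size L) * real s"
      using ratios pos by (simp add: ratio_def N divide_simps mult_ac)
    then have "ratio (N, t) < ratio (L, t - s)"
      using lt pos by (simp add: ratio_def N divide_simps of_nat_diff algebra_simps)
    moreover obtain j' where j': "j = Suc j'" using \<open>i < j\<close> by (cases j) auto
    ultimately have "ratio (x j') < ratio (L, t - s)"
      using incr Nt by (metis lessI order.strict_trans strict_mono_def)
    then have "snd (x j) \<le> t - s"
      using step[of j'] cL unfolding step_def j' by auto
    then show False using Nt pos lt by simp
  qed
  then obtain M s where max: "conf (M, s)" "\<And>y. conf y \<Longrightarrow> ratio y \<le> ratio (M, s)" by auto
  have "fractional_domatic_number G = ereal (real (size M) / real s)"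
    unfolding fractional_domatic_number_def
  proof (rule Sup_eqI)
    fix y assume "y \<in> {ereal (real k / real s) | k s. \<exists>M. configuration G k s M}"
    then obtain k s' N where "y = ereal (real k / real s')" "configuration G k s' N" by blast
    then show "y \<le> ereal (real (size M) / real s)"
      using max(2)[of "(N, s')"] by (auto simp: conf_def ratio_def configuration_def)
  next
    fix y assume "\<And>z. z \<in> {ereal (real k / real s) | k s. \<exists>M. configuration G k s M} \<Longrightarrow> z \<le> y"
    then show "ereal (real (size M) / real s) \<le> y"
      using max(1) by (auto simp: conf_def)
  qed
  then show ?thesis using max(1) by (auto simp: conf_def)
qed

end

theory Submission
  imports Defs
begin

text \<open>
  A vertex \<open>v\<close> is slack if some multiset of dominating sets covers every vertex by at most half of
  its members, and \<open>v\<close> by strictly less than half.  Taking the union of such multisets over all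
  vertices shows that the fractional domatic number exceeds 2 as soon as every vertex is slack.

  If no vertex is isolated outside a star with centre \<open>x\<close> and leaves \<open>L\<close>, the rest of the graph splits
  into two sets dominating each other, and either part may be joined to \<open>x\<close> or to \<open>L\<close>.  In any
  weighting dual to slackness, \<open>x\<close> therefore weighs as much as \<open>L\<close>.  With minimum degree 2, comparing
  such stars makes all vertices of a star with at least two leaves slack, and makes slackness
  spread along edges.  For a vertex \<open>x\<close> that is not slack, the star on two neighbours \<open>y\<close>, \<open>z\<close> of \<open>x\<close>
  has to isolate another vertex, whose neighbourhood is then \<open>{y, z}\<close>; applying this around the
  resulting 4-cycle shows that the cycle is a component.
\<close>

section \<open>Coverage counts of multisets of sets\<close>

definition coverage :: "'a set multiset \<Rightarrow> 'a \<Rightarrow> nat" where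
  "coverage M v = size {#D \<in># M. v \<in> D#}"

lemma coverage_simps [simp]:
  "coverage {#} v = 0"
  "coverage (add_mset D M) v = of_bool (v \<in> D) + coverage M v"
  "coverage (M + N) v = coverage M v + coverage N v"
  by (simp_all add: coverage_def)

lemma coverage_repeat_mset [simp]: "coverage (repeat_mset n M) v = n * coverage M v"
  by (induction n) simp_all

text \<open>Double counting of the pairs of a member \<open>D\<close> of \<open>M\<close> and a
  vertex of \<open>D\<close> in \<open>S\<close>.\<close>

lemma sum_coverage_ge:
  assumes "\<forall>D \<in># M. n \<le> card (D \<inter> S)" and "finite S"
  shows "n * size M \<le> (\<Sum>v\<in>S. coverage M v)"
  using assms(1)
proof (induction M)
  case (add D M)
  have "(\<Sum>v\<in>S. of_bool (v \<in> D)) = card (D \<inter> S)"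
    using assms(2) by (simp add: Int_commute)
  with add show ?case by (simp add: sum.distrib)
qed simp

section \<open>The cone of slack functions\<close>

context pair_graph
begin

text \<open>
  The functions \<open>u\<close> with \<open>slack u\<close> form a downward closed cone; a weighting \<open>w\<close> is dual to it if
  \<open>\<Sum>v. w v * u v \<le> 0\<close> for all of them.
\<close>

definition slack :: "('a \<Rightarrow> int) \<Rightarrow> bool" where
  "slack u \<longleftrightarrow> (\<exists>M. (\<forall>D \<in># M. dominating_set G D) \<and>
     (\<forall>v \<in> pverts G. u v + 2 * int (coverage M v) \<le> int (size M)))"

abbreviation slack_at :: "'a \<Rightarrow> bool" where
  "slack_at x \<equiv> slack (\<lambda>v. of_bool (v = x))"

definition no_isolated :: "'a set \<Rightarrow> bool" where
  "no_isolated U \<longleftrightarrow> (\<forall>u \<in> U. \<exists>w \<in> U. (u, w) \<in> parcs G)"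

text \<open>The equivalences fix the full neighbourhoods in \<open>G\<close>, so the cycle has no
  chord and no edge leaves it.\<close>

definition is_four_cycle :: "'a \<Rightarrow> 'a \<Rightarrow> 'a \<Rightarrow> 'a \<Rightarrow> bool" where
  "is_four_cycle a b c d \<longleftrightarrow> distinct [a, b, c, d] \<and>
     (\<forall>w. ((a, w) \<in> parcs G \<longleftrightarrow> w \<in> {b, d}) \<and> ((b, w) \<in> parcs G \<longleftrightarrow> w \<in> {a, c}) \<and>
          ((c, w) \<in> parcs G \<longleftrightarrow> w \<in> {b, d}) \<and> ((d, w) \<in> parcs G \<longleftrightarrow> w \<in> {a, c}))"

lemma no_isolated_Un: "no_isolated U \<Longrightarrow> no_isolated W \<Longrightarrow> no_isolated (U \<union> W)"
  unfolding no_isolated_def by blast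

text \<open>As \<open>A\<close> one takes an inclusion-minimal dominating set of the subgraph induced by \<open>U\<close>.\<close>

lemma no_isolated_split:
  assumes "finite U" and "no_isolated U"
  obtains A where "A \<subseteq> U"
    and "\<And>u. u \<in> A \<Longrightarrow> \<exists>w \<in> U - A. (u, w) \<in> parcs G"
    and "\<And>u. u \<in> U - A \<Longrightarrow> \<exists>w \<in> A. (u, w) \<in> parcs G"
proof -
  define P where "P = (\<lambda>A. A \<subseteq> U \<and> (\<forall>u \<in> U - A. \<exists>w \<in> A. (u, w) \<in> parcs G))"
  have "finite {A. P A}"
    using assms(1) by (auto simp: P_def intro: finite_subset[of _ "Pow U"])
  moreover have "P U" by (simp add: P_def)
  ultimately obtain A where A: "P A" and min: "\<And>B. P B \<Longrightarrow> B \<subseteq> A \<Longrightarrow> A = B"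
    using finite_has_minimal[of "{A. P A}"] by auto
  have "\<exists>w \<in> U - A. (u, w) \<in> parcs G" if "u \<in> A" for u
  proof (rule ccontr)
    assume no: "\<not> ?thesis"
    obtain w where w: "w \<in> U" "(u, w) \<in> parcs G"
      using assms(2) A \<open>u \<in> A\<close> unfolding no_isolated_def P_def by blast
    have "w \<in> A - {u}" using w no no_loops' by auto
    \<comment> \<open>\<open>w\<close> still dominates \<open>u\<close>, and no vertex of
      \<open>U - A\<close> loses a dominator, because none is adjacent to \<open>u\<close>.\<close>
    then have "P (A - {u})"
      using A w no arcs_symmetric unfolding P_def by blast
    with min[of "A - {u}"] \<open>u \<in> A\<close> show False by auto
  qed
  with A that show ?thesis by (auto simp: P_def)
qed

lemma slack_add:
  assumes "slack f" and "slack g"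
  shows "slack (\<lambda>v. f v + g v)"
proof -
  obtain M where M: "\<forall>D \<in># M. dominating_set G D"
    "\<forall>v \<in> pverts G. f v + 2 * int (coverage M v) \<le> int (size M)"
    using assms(1) by (auto simp: slack_def)
  obtain N where N: "\<forall>D \<in># N. dominating_set G D"
    "\<forall>v \<in> pverts G. g v + 2 * int (coverage N v) \<le> int (size N)"
    using assms(2) by (auto simp: slack_def)
  show ?thesis unfolding slack_def
  proof (intro exI[of _ "M + N"] conjI ballI)
    fix D assume "D \<in># M + N"
    then show "dominating_set G D" using M(1) N(1) by auto
  next
    fix v assume "v \<in> pverts G"
    then show "f v + g v + 2 * int (coverage (M + N) v) \<le> int (size (M + N))"
      using M(2) N(2) by (smt (verit) coverage_simps(3) of_nat_add size_union)
  qed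
qed

lemma slack_mono:
  assumes "slack f" and "\<And>v. v \<in> pverts G \<Longrightarrow> g v \<le> f v"
  shows "slack g"
proof -
  obtain M where "\<forall>D \<in># M. dominating_set G D"
    "\<forall>v \<in> pverts G. f v + 2 * int (coverage M v) \<le> int (size M)"
    using assms(1) by (auto simp: slack_def)
  with assms(2) show ?thesis
    unfolding slack_def by (intro exI[of _ M]) (meson add_right_mono order_trans)
qed

lemma slack_sum:
  assumes "\<And>i. i \<in> I \<Longrightarrow> slack (f i)"
  shows "slack (\<lambda>v. \<Sum>i\<in>I. f i v)"
proof -
  have 0: "slack (\<lambda>_. 0)" unfolding slack_def by (intro exI[of _ "{#}"]) simp
  show ?thesis
    using assms
    by (induction I rule: infinite_finite_induct) (auto intro: 0 slack_add)
qed

text \<open>Each witness is a pair of dominating sets, built from a split of the remaining vertices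
  \<open>U\<close> into \<open>A\<close> and \<open>U - A\<close>. The pair covers every vertex of
  \<open>U\<close> once; joining both parts to \<open>x\<close> covers \<open>x\<close> twice and
  \<open>L\<close> never, and joining both to \<open>L\<close> does the reverse.\<close>

lemma slack_star:
  assumes "x \<in> pverts G" and "L \<noteq> {}" and adj: "\<And>y. y \<in> L \<Longrightarrow> (x, y) \<in> parcs G"
    and "no_isolated (pverts G - insert x L)"
  shows "slack (\<lambda>v. 2 * of_bool (v \<in> L) - 2 * of_bool (v = x))"
    and "slack (\<lambda>v. 2 * of_bool (v = x) - 2 * of_bool (v \<in> L))"
proof -
  define U where "U = pverts G - insert x L"
  obtain A where A: "A \<subseteq> U"
    "\<And>u. u \<in> A \<Longrightarrow> \<exists>w \<in> U - A. (u, w) \<in> parcs G"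
    "\<And>u. u \<in> U - A \<Longrightarrow> \<exists>w \<in> A. (u, w) \<in> parcs G"
    using no_isolated_split[of U] assms(4) pair_finite_verts by (auto simp: U_def)
  have LV: "L \<subseteq> pverts G" using adj in_arcsD2 by blast
  have xL: "x \<notin> L" using adj no_loops' by blast
  have V: "pverts G = insert x (L \<union> U)" using LV assms(1) by (auto simp: U_def)
  have U: "x \<notin> U" "L \<inter> U = {}" by (auto simp: U_def)
  obtain l where l: "l \<in> L" using assms(2) by blast
  have adj': "(y, x) \<in> parcs G" if "y \<in> L" for y using adj that arcs_symmetric by blast
  have dom: "dominating_set G (insert x A)" "dominating_set G (insert x (U - A))"
    "dominating_set G (L \<union> A)" "dominating_set G (L \<union> (U - A))"
    unfolding dominating_set_def with_proj_simps V
    using A U adj adj' l by blast+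
  have [simp]: "v \<in> A \<Longrightarrow> v \<in> U" for v using A(1) by auto
  show "slack (\<lambda>v. 2 * of_bool (v \<in> L) - 2 * of_bool (v = x))"
    unfolding slack_def
    using dom xL U A(1) by (intro exI[of _ "{#insert x A, insert x (U - A)#}"]) (auto simp: V)
  show "slack (\<lambda>v. 2 * of_bool (v = x) - 2 * of_bool (v \<in> L))"
    unfolding slack_def
    using dom xL U A(1) by (intro exI[of _ "{#L \<union> A, L \<union> (U - A)#}"]) (auto simp: V)
qed

end

section \<open>Slack vertices under minimum degree two\<close>

locale min_degree_two = pair_graph +
  assumes two_neighbours: "v \<in> pverts G \<Longrightarrow> \<exists>a b. a \<noteq> b \<and> (v, a) \<in> parcs G \<and> (v, b) \<in> parcs G"
begin

lemma other_neighbour: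
  assumes "v \<in> pverts G"
  obtains w where "(v, w) \<in> parcs G" and "w \<noteq> a"
  using two_neighbours[OF assms] by metis

text \<open>Releasing a set \<open>S\<close> of leaves containing \<open>y\<close> gives a smaller
  star at \<open>x\<close>. Adding the two opposite star functions for \<open>L\<close> and
  \<open>L - S\<close> cancels everything but twice the indicator of \<open>S\<close>. A neighbour
  \<open>z\<close> of \<open>y\<close> other than \<open>x\<close> keeps the released vertices from
  being isolated.\<close>

lemma slack_at_leaf:
  assumes "x \<in> pverts G" and y: "y \<in> L" and L: "L \<noteq> {y}"
    and adj: "\<And>y. y \<in> L \<Longrightarrow> (x, y) \<in> parcs G"
    and iso: "no_isolated (pverts G - insert x L)"
  shows "slack_at y"
proof -
  have LV: "L \<subseteq> pverts G" using adj in_arcsD2 by blast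
  have xL: "x \<notin> L" using adj no_loops' by blast
  have star: "slack (\<lambda>v. 2 * of_bool (v \<in> L) - 2 * of_bool (v = x))"
    using slack_star(1)[OF assms(1) _ adj iso] y by auto
  obtain z where z: "(y, z) \<in> parcs G" "z \<noteq> x" using other_neighbour[of y x] y LV by blast
  have zV: "z \<in> pverts G" and zy: "(z, y) \<in> parcs G" and ne: "z \<noteq> y"
    using z in_arcsD2 arcs_symmetric no_loops' by blast+
  have smaller: "slack_at y" if "S \<subseteq> L" "y \<in> S" "L - S \<noteq> {}" "no_isolated (pverts G - insert x (L - S))" for S
  proof -
    have "slack (\<lambda>v. 2 * of_bool (v = x) - 2 * of_bool (v \<in> L - S))"
      using slack_star(2)[OF assms(1) that(3) _ that(4)] adj by blast
    from slack_add[OF star this] show ?thesis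
      by (rule slack_mono) (use that in auto)
  qed
  show ?thesis
  proof (cases "z \<in> L")
    case False
    \<comment> \<open>\<open>y\<close> alone can be released, as its neighbour \<open>z\<close>
      already lies outside the star.\<close>
    have "no_isolated (pverts G - insert x (L - {y}))"
      using iso z zy zV False unfolding no_isolated_def by blast
    with smaller[of "{y}"] y L show ?thesis by auto
  next
    case zL: True
    show ?thesis
    proof (cases "L = {y, z}")
      case False
      \<comment> \<open>Here \<open>y\<close> and \<open>z\<close> are released together and serve
        as neighbours of each other; \<open>L\<close> keeps a further leaf.\<close>
      have "no_isolated {y, z}" using z zy by (simp add: no_isolated_def)
      moreover have "pverts G - insert x (L - {y, z}) = (pverts G - insert x L) \<union> {y, z}"
        using y zL LV xL by blast
      ultimately have "no_isolated (pverts G - insert x (L - {y, z}))"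
        using no_isolated_Un[OF iso] by metis
      with smaller[of "{y, z}"] y zL False show ?thesis by auto
    next
      case True
      \<comment> \<open>Now \<open>x\<close>, \<open>y\<close>, \<open>z\<close> form a triangle, so
        \<open>z\<close> can also be the centre, with leaves \<open>x\<close> and \<open>y\<close>.
        The two star functions add up to 4 at \<open>y\<close> and 0 elsewhere.\<close>
      have xz: "(z, x) \<in> parcs G" using adj zL arcs_symmetric by blast
      have "slack (\<lambda>v. 2 * of_bool (v \<in> {x, y}) - 2 * of_bool (v = z))"
        using slack_star(1)[of z "{x, y}"] zV iso xz zy unfolding True
        by (auto simp: insert_commute)
      from slack_add[OF star this] show ?thesis
        by (rule slack_mono) (use True ne xL in auto)
    qed
  qed
qed

text \<open>All leaves are slack, so the indicator of \<open>L\<close> is a slack function. Twice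
  this function offsets the loss on \<open>L\<close> in the star function that is positive at
  \<open>x\<close>.\<close>

lemma slack_at_centre:
  assumes "x \<in> pverts G" and y: "y \<in> L" and L: "L \<noteq> {y}"
    and adj: "\<And>y. y \<in> L \<Longrightarrow> (x, y) \<in> parcs G"
    and iso: "no_isolated (pverts G - insert x L)"
  shows "slack_at x"
proof -
  have LV: "L \<subseteq> pverts G" using adj in_arcsD2 by blast
  then have fin: "finite L" using pair_finite_verts finite_subset by blast
  have "slack_at l" if "l \<in> L" for l
    using slack_at_leaf[OF assms(1) that _ adj iso] y L that by blast
  then have "slack (\<lambda>v. \<Sum>l\<in>L. of_bool (v = l))" by (rule slack_sum)
  moreover have "(\<Sum>l\<in>L. of_bool (v = l)) = (of_bool (v \<in> L) :: int)" for v
    using fin by simp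
  ultimately have leaves: "slack (\<lambda>v. of_bool (v \<in> L))" by simp
  have star: "slack (\<lambda>v. 2 * of_bool (v = x) - 2 * of_bool (v \<in> L))"
    using slack_star(2)[OF assms(1) _ adj iso] y by auto
  from slack_add[OF slack_add[OF leaves leaves] star] show ?thesis
    by (rule slack_mono) auto
qed

text \<open>Let \<open>I\<close> consist of the vertices isolated by deleting \<open>x\<close> and
  \<open>y\<close>. If \<open>I\<close> is empty, the star with the single leaf \<open>y\<close>
  moves slack from \<open>x\<close> to \<open>y\<close>. Otherwise every vertex of \<open>I\<close>
  is adjacent to \<open>x\<close>, having a neighbour other than \<open>y\<close>, so
  \<open>y\<close> is one of at least two leaves of a star at \<open>x\<close>.\<close>

lemma slack_at_adjacent:
  assumes xy: "(x, y) \<in> parcs G" and x: "slack_at x"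
  shows "slack_at y"
proof -
  have V: "x \<in> pverts G" "y \<in> pverts G" and ne: "x \<noteq> y"
    using xy in_arcsD1 in_arcsD2 no_loops' by blast+
  define I where "I = {i \<in> pverts G - {x, y}. \<forall>w. (i, w) \<in> parcs G \<longrightarrow> w \<in> {x, y}}"
  have iso: "no_isolated (pverts G - insert x (insert y I))"
    unfolding no_isolated_def
  proof
    fix u assume u: "u \<in> pverts G - insert x (insert y I)"
    then obtain w where w: "(u, w) \<in> parcs G" "w \<notin> {x, y}" by (auto simp: I_def)
    \<comment> \<open>A member of \<open>I\<close> has neighbours only in \<open>{x, y}\<close>,
      whereas \<open>w\<close> is adjacent to \<open>u\<close>.\<close>
    then have "w \<notin> I" using u arcs_symmetric by (auto simp: I_def)
    with w show "\<exists>w \<in> pverts G - insert x (insert y I). (u, w) \<in> parcs G"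
      using in_arcsD2 by blast
  qed
  show ?thesis
  proof (cases "I = {}")
    case True
    have "slack (\<lambda>v. 2 * of_bool (v = y) - 2 * of_bool (v = x))"
      using slack_star(1)[of x "{y}"] V xy iso True by simp
    from slack_add[OF slack_add[OF x x] this] show ?thesis
      by (rule slack_mono) auto
  next
    case False
    have adj: "(x, i) \<in> parcs G" if "i \<in> I" for i
    proof -
      have i: "i \<in> pverts G" "\<And>w. (i, w) \<in> parcs G \<Longrightarrow> w \<in> {x, y}"
        using that by (auto simp: I_def)
      obtain w where "(i, w) \<in> parcs G" "w \<noteq> y" using other_neighbour[OF i(1), of y] .
      with i(2) have "(i, x) \<in> parcs G" by fastforce
      then show ?thesis by (rule arcs_symmetric)
    qed
    have "insert y I \<noteq> {y}" using False by (auto simp: I_def)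
    with adj xy show ?thesis
      by (intro slack_at_leaf[OF V(1) _ _ _ iso]) auto
  qed
qed

text \<open>Let \<open>I\<close> consist of the vertices isolated by deleting \<open>x\<close>,
  \<open>y\<close> and \<open>z\<close>. If \<open>x\<close> were adjacent to all of
  \<open>I\<close>, it would be the centre of a star with leaves \<open>{y, z} \<union> I\<close>
  and hence slack. So some \<open>i\<close> in \<open>I\<close> is not adjacent to \<open>x\<close>,
  and minimum degree two makes its neighbourhood exactly \<open>{y, z}\<close>.\<close>

lemma opposite_vertex:
  assumes x: "\<not> slack_at x" and xy: "(x, y) \<in> parcs G" and xz: "(x, z) \<in> parcs G" and ne: "y \<noteq> z"
  obtains i where "i \<noteq> x" and "\<forall>w. (i, w) \<in> parcs G \<longleftrightarrow> w \<in> {y, z}"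
proof -
  have V: "x \<in> pverts G" using xy in_arcsD1 by blast
  define I where "I = {i \<in> pverts G - {x, y, z}. \<forall>w. (i, w) \<in> parcs G \<longrightarrow> w \<in> {x, y, z}}"
  have iso: "no_isolated (pverts G - insert x ({y, z} \<union> I))"
    unfolding no_isolated_def
  proof
    fix u assume u: "u \<in> pverts G - insert x ({y, z} \<union> I)"
    then obtain w where w: "(u, w) \<in> parcs G" "w \<notin> {x, y, z}" by (auto simp: I_def)
    then have "w \<notin> I" using u arcs_symmetric by (auto simp: I_def)
    with w show "\<exists>w \<in> pverts G - insert x ({y, z} \<union> I). (u, w) \<in> parcs G"
      using in_arcsD2 by blast
  qed
  have "\<not> (\<forall>i \<in> I. (x, i) \<in> parcs G)"
  proof
    assume "\<forall>i \<in> I. (x, i) \<in> parcs G"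
    then have "\<And>l. l \<in> {y, z} \<union> I \<Longrightarrow> (x, l) \<in> parcs G" using xy xz by blast
    with V ne iso have "slack_at x" by (intro slack_at_centre[of x y "{y, z} \<union> I"]) auto
    with x show False ..
  qed
  then obtain i where i: "i \<in> I" "(x, i) \<notin> parcs G" by blast
  have sub: "w \<in> {y, z}" if "(i, w) \<in> parcs G" for w
  proof -
    have "w \<in> {x, y, z}" using i(1) that by (simp add: I_def)
    moreover have "w \<noteq> x" using i(2) that arcs_symmetric by metis
    ultimately show ?thesis by simp
  qed
  have iV: "i \<in> pverts G" "i \<noteq> x" using i by (auto simp: I_def)
  obtain w w' where "w \<noteq> w'" "(i, w) \<in> parcs G" "(i, w') \<in> parcs G"
    using two_neighbours[OF iV(1)] by metis
  with sub[of w] sub[of w'] have "(i, y) \<in> parcs G" "(i, z) \<in> parcs G" by auto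
  with sub have "\<forall>w. (i, w) \<in> parcs G \<longleftrightarrow> w \<in> {y, z}" by auto
  with iV(2) show ?thesis by (rule that)
qed

text \<open>The vertex \<open>i\<close> opposite to \<open>x\<close> closes a 4-cycle. Slackness
  spreads along edges, so none of its vertices is slack, and \<open>opposite_vertex\<close> applied
  at each determines the neighbourhood of the opposite one.\<close>

lemma four_cycle_of_not_slack_at:
  assumes "x \<in> pverts G" and x: "\<not> slack_at x"
  obtains y i z where "is_four_cycle x y i z"
proof -
  obtain y z where ne: "y \<noteq> z" and xy: "(x, y) \<in> parcs G" and xz: "(x, z) \<in> parcs G"
    using two_neighbours assms(1) by blast
  obtain i where ix: "i \<noteq> x" and i: "\<forall>w. (i, w) \<in> parcs G \<longleftrightarrow> w \<in> {y, z}"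
    by (rule opposite_vertex[OF x xy xz ne])
  note i = i[rule_format]
  have yx: "(y, x) \<in> parcs G" and zx: "(z, x) \<in> parcs G"
    and yi: "(y, i) \<in> parcs G" and zi: "(z, i) \<in> parcs G"
    using xy xz i by (auto intro: arcs_symmetric)
  have y: "\<not> slack_at y" and z: "\<not> slack_at z"
    using x slack_at_adjacent[OF yx] slack_at_adjacent[OF zx] by blast+
  then have nsi: "\<not> slack_at i" using slack_at_adjacent[of i y] i[of y] by blast
  have nbrs_z: "(z, w) \<in> parcs G \<longleftrightarrow> w \<in> {x, i}" for w
  proof -
    obtain j where "j \<noteq> y" and j: "\<forall>w. (j, w) \<in> parcs G \<longleftrightarrow> w \<in> {x, i}"
      by (rule opposite_vertex[OF y yx yi ix[symmetric]])
    note j = j[rule_format]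
    \<comment> \<open>The vertex \<open>j\<close> opposite to \<open>y\<close> must be
      \<open>z\<close>, since \<open>i\<close> is adjacent to \<open>j\<close> and has only the
      neighbours \<open>y\<close> and \<open>z\<close>.\<close>
    have "(i, j) \<in> parcs G" using j[of i] by (auto intro: arcs_symmetric)
    with i[of j] \<open>j \<noteq> y\<close> have "j = z" by simp
    with j show ?thesis by simp
  qed
  have nbrs_y: "(y, w) \<in> parcs G \<longleftrightarrow> w \<in> {x, i}" for w
  proof -
    obtain j where "j \<noteq> z" and j: "\<forall>w. (j, w) \<in> parcs G \<longleftrightarrow> w \<in> {x, i}"
      by (rule opposite_vertex[OF z zx zi ix[symmetric]])
    note j = j[rule_format]
    have "(i, j) \<in> parcs G" using j[of i] by (auto intro: arcs_symmetric)
    with i[of j] \<open>j \<noteq> z\<close> have "j = y" by simp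
    with j show ?thesis by simp
  qed
  have nbrs_x: "(x, w) \<in> parcs G \<longleftrightarrow> w \<in> {y, z}" for w
  proof -
    have "(i, y) \<in> parcs G" "(i, z) \<in> parcs G" using i by simp_all
    then obtain j where "j \<noteq> i" and j: "\<forall>w. (j, w) \<in> parcs G \<longleftrightarrow> w \<in> {y, z}"
      by (rule opposite_vertex[OF nsi _ _ ne])
    note j = j[rule_format]
    have "(y, j) \<in> parcs G" using j[of y] by (auto intro: arcs_symmetric)
    with nbrs_y[of j] \<open>j \<noteq> i\<close> have "j = x" by simp
    with j show ?thesis by simp
  qed
  have "distinct [x, y, i, z]"
    using ix ne no_loops'[OF xy] no_loops'[OF xz] no_loops'[OF yi] no_loops'[OF zi] by auto
  then have "is_four_cycle x y i z"
    unfolding is_four_cycle_def using nbrs_x nbrs_y i nbrs_z by simp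
  with that show ?thesis .
qed

end

section \<open>Bounds on the fractional domatic number\<close>

context pair_graph
begin

lemma configuration_le:
  assumes "configuration G k s M"
  shows "ereal (real k / real s) \<le> fractional_domatic_number G"
  unfolding fractional_domatic_number_def using assms by (intro Sup_upper) blast

text \<open>A split of all vertices into two dominating sets is a (2,1)-configuration.\<close>

lemma fractional_domatic_number_ge_two:
  assumes "no_isolated (pverts G)"
  shows "2 \<le> fractional_domatic_number G"
proof -
  obtain A where A: "A \<subseteq> pverts G"
    "\<And>u. u \<in> A \<Longrightarrow> \<exists>w \<in> pverts G - A. (u, w) \<in> parcs G"
    "\<And>u. u \<in> pverts G - A \<Longrightarrow> \<exists>w \<in> A. (u, w) \<in> parcs G"
    using no_isolated_split assms pair_finite_verts by blast
  have "configuration G 2 1 {#A, pverts G - A#}"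
    using A by (auto simp: configuration_def dominating_set_def)
  from configuration_le[OF this] show ?thesis by simp
qed

lemma fractional_domatic_number_gt_two:
  assumes "\<And>v. v \<in> pverts G \<Longrightarrow> slack_at v"
  shows "2 < fractional_domatic_number G"
proof -
  have "slack (\<lambda>v. \<Sum>x\<in>pverts G. of_bool (v = x))"
    using assms by (rule slack_sum)
  moreover have "(\<Sum>x\<in>pverts G. of_bool (v = x)) = (of_bool (v \<in> pverts G) :: int)" for v
    using pair_finite_verts by simp
  ultimately obtain M where M: "\<forall>D \<in># M. dominating_set G D"
    "\<And>v. v \<in> pverts G \<Longrightarrow> 1 + 2 * int (coverage M v) \<le> int (size M)"
    by (auto simp: slack_def)
  \<comment> \<open>\<open>M\<close> can be empty only if \<open>G\<close> has no vertices; the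
    default makes the size positive in that case too.\<close>
  define N where "N = (if M = {#} then {#pverts G#} else M)"
  have pos: "0 < size N" by (simp add: N_def nonempty_has_size)
  have dom: "\<forall>D \<in># N. dominating_set G D"
    using M(1) by (simp add: N_def dominating_set_def)
  have cov: "1 + 2 * coverage N v \<le> size N" if "v \<in> pverts G" for v
    using M(2)[OF that] by (auto simp: N_def)
  \<comment> \<open>With \<open>n = size N\<close>, each vertex is covered at most
    \<open>2 * n - 2\<close> times by \<open>4 * n\<close> sets. The bound \<open>2 * n - 1\<close>
    is positive even for \<open>n = 1\<close>, and the ratio still exceeds 2.\<close>
  have "configuration G (4 * size N) (2 * size N - 1) (repeat_mset 4 N)"
    unfolding configuration_def
  proof (intro conjI ballI)
    fix v assume "v \<in> verts G"
    then have "coverage (repeat_mset 4 N) v \<le> 2 * size N - 1" using cov[of v] by simp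
    then show "size {#D \<in># repeat_mset 4 N. v \<in> D#} \<le> 2 * size N - 1"
      by (simp add: coverage_def)
  next
    fix D assume "D \<in># repeat_mset 4 N"
    then show "dominating_set G D"
      using dom by (simp flip: count_greater_zero_iff)
  qed (use pos in auto)
  from configuration_le[OF this]
  have "ereal (real (4 * size N) / real (2 * size N - 1)) \<le> fractional_domatic_number G" .
  moreover have "2 < real (4 * size N) / real (2 * size N - 1)"
    using pos by (simp add: field_simps of_nat_diff)
  then have "2 < ereal (real (4 * size N) / real (2 * size N - 1))"
    by (simp only: numeral_eq_ereal less_ereal.simps)
  ultimately show ?thesis by (rule order_less_le_trans[rotated])
qed

text \<open>The set \<open>S\<close> is a dual certificate: counting incidences with
  \<open>S\<close> in a configuration gives \<open>n * k \<le> 2 * n * s\<close>.\<close>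

lemma fractional_domatic_number_le_two:
  assumes S: "S \<subseteq> pverts G" "card S = 2 * n" "0 < n"
    and half: "\<And>D. dominating_set G D \<Longrightarrow> n \<le> card (D \<inter> S)"
  shows "fractional_domatic_number G \<le> 2"
  unfolding fractional_domatic_number_def
proof (rule Sup_least)
  fix r assume "r \<in> {ereal (real k / real s) |k s. \<exists>M. configuration G k s M}"
  then obtain k s M where r: "r = ereal (real k / real s)" and c: "configuration G k s M" by blast
  have "n * size M \<le> (\<Sum>v\<in>S. coverage M v)"
    using c half S pair_finite_verts
    by (intro sum_coverage_ge) (auto simp: configuration_def intro: finite_subset)
  also have "\<dots> \<le> (\<Sum>v\<in>S. s)"
    using c S by (intro sum_mono) (auto simp: configuration_def coverage_def)
  also have "\<dots> = n * (2 * s)" using S by simp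
  finally have "k \<le> 2 * s" using S c by (simp add: configuration_def)
  moreover have "0 < s" using c by (simp add: configuration_def)
  ultimately have "real k / real s \<le> 2" by (simp add: divide_simps)
  then show "r \<le> 2" by (simp add: r)
qed

lemma out_degree_eq_card: "out_degree G v = card {w. (v, w) \<in> parcs G}"
proof -
  have "out_arcs G v = Pair v ` {w. (v, w) \<in> parcs G}"
    by (auto simp: out_arcs_def)
  then show ?thesis by (simp add: out_degree_def card_image inj_on_def)
qed

text \<open>Every dominating set meets the closed neighbourhood of \<open>v\<close>, which consists
  of two vertices.\<close>

lemma fractional_domatic_number_le_two_of_leaf:
  assumes "v \<in> pverts G" and "out_degree G v = 1"
  shows "fractional_domatic_number G \<le> 2"
proof -
  obtain u where u: "{w. (v, w) \<in> parcs G} = {u}"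
    using assms(2) unfolding out_degree_eq_card by (auto simp: card_1_singleton_iff)
  then have vu: "(v, u) \<in> parcs G" by blast
  show ?thesis
  proof (rule fractional_domatic_number_le_two[of "{v, u}" 1])
    show "{v, u} \<subseteq> pverts G" "card {v, u} = 2 * 1"
      using vu in_arcsD1 in_arcsD2 no_loops' by auto
    fix D assume "dominating_set G D"
    then have "D \<inter> {v, u} \<noteq> {}"
      using assms(1) u unfolding dominating_set_def by auto
    then show "1 \<le> card (D \<inter> {v, u})"
      by (simp add: Suc_le_eq card_gt_0_iff)
  qed simp
qed

section \<open>Four-cycles as connected components\<close>

text \<open>Adding the arc and its head to \<open>H\<close> keeps it a connected subgraph, so
  maximality of \<open>H\<close> puts the arc in \<open>H\<close> already. A single arc is enough,
  since connectedness refers to the symmetric closure.\<close>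

lemma adjacent_mem_component:
  assumes H: "H \<in> connected_components G" and a: "a \<in> verts H" and aw: "(a, w) \<in> parcs G"
  shows "(a, w) \<in> arcs H"
proof -
  have max: "max_subgraph Digraph_Component.connected H"
    using H by (simp add: connected_components_def)
  have sub: "subgraph H G" and con: "Digraph_Component.connected H"
    using max by (auto simp: max_subgraph_def)
  have th: "tail H = fst" "head H = snd"
    using sub by (auto simp: subgraph_def compatible_def)
  define H' where
    "H' = \<lparr>verts = insert w (verts H), arcs = insert (a, w) (arcs H), tail = fst, head = snd\<rparr>"
  have wf: "wf_digraph H" using sub by (simp add: subgraph_def)
  have "wf_digraph H'"
    using wf a th unfolding wf_digraph_def H'_def by auto
  then have subs: "subgraph H H'" "subgraph H' G"
    using sub wf aw in_arcsD2 unfolding subgraph_def compatible_def H'_def by (auto simp: th)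
  interpret S: pair_wf_digraph "mk_symmetric H'"
    using \<open>wf_digraph H'\<close> by (rule wf_digraph.wellformed_mk_symmetric)
  have aw': "(a, w) \<in> parcs (mk_symmetric H')" "(w, a) \<in> parcs (mk_symmetric H')"
    by (auto simp: parcs_mk_symmetric H'_def)
  have old: "u \<rightarrow>\<^sup>*\<^bsub>mk_symmetric H'\<^esub> v" if "u \<in> verts H" "v \<in> verts H" for u v
    using con that subgraph_mk_symmetric[OF subs(1)]
    by (intro S.reachable_mono[of "with_proj (mk_symmetric H)"])
      (auto simp: Digraph_Component.connected_def strongly_connected_def)
  have to_a: "u \<rightarrow>\<^sup>*\<^bsub>mk_symmetric H'\<^esub> a" if "u \<in> verts H'" for u
    using that old[OF _ a] S.reachable_adjI aw' by (auto simp: H'_def)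
  have from_a: "a \<rightarrow>\<^sup>*\<^bsub>mk_symmetric H'\<^esub> u" if "u \<in> verts H'" for u
    using to_a[OF that] symmetric_mk_symmetric by (rule symmetric_reachable[rotated])
  have "verts H' \<noteq> {}" by (simp add: H'_def)
  then have "Digraph_Component.connected H'"
    unfolding Digraph_Component.connected_def strongly_connected_def
    using S.reachable_trans[OF to_a from_a] by simp
  with max subs have "H' = H" by (auto simp: max_subgraph_def)
  then have "arcs H' = arcs H" by simp
  then show ?thesis by (auto simp: H'_def)
qed

text \<open>The four vertices are preimages of 0, 1, 2, 3. Their neighbourhoods in \<open>G\<close>
  agree with those in \<open>H\<close>, because a component contains every arc of \<open>G\<close>
  leaving its vertices.\<close>

lemma four_cycle_of_component:
  assumes H: "H \<in> connected_components G" and "digraph_iso H (with_proj C4)"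
  obtains a b c d where "is_four_cycle a b c d"
proof -
  obtain f where f: "pre_digraph.digraph_isomorphism H f" and C4: "with_proj C4 = app_iso f H"
    using assms(2) by (auto simp: digraph_iso_def)
  have sub: "subgraph H G"
    using H by (simp add: connected_components_def max_subgraph_def)
  have th: "tail H = fst" "head H = snd"
    using sub by (auto simp: subgraph_def compatible_def)
  define g where "g = iso_verts f"
  have inj: "inj_on g (verts H)"
    using f by (simp add: pre_digraph.digraph_isomorphism_def g_def)
  have verts: "g ` verts H = {0, 1, 2, 3}"
    using arg_cong[OF C4, of verts] by (simp add: g_def C4_def)
  have arcs: "iso_arcs f ` arcs H = parcs C4" "iso_tail f = fst" "iso_head f = snd"
    using arg_cong[OF C4, of arcs] arg_cong[OF C4, of tail] arg_cong[OF C4, of head] by simp_all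
  \<comment> \<open>An isomorphism may map arcs by a function of its own; as arcs of
    \<open>C4\<close> are pairs of their endpoints, \<open>g\<close> determines this
    function.\<close>
  have iso_arc: "iso_arcs f e = (g (fst e), g (snd e))" if "e \<in> arcs H" for e
    using f that unfolding pre_digraph.digraph_isomorphism_def
    by (auto simp: th arcs g_def prod_eq_iff)
  have wf: "fst e \<in> verts H" "snd e \<in> verts H" if "e \<in> arcs H" for e
    using sub that wf_digraph.tail_in_verts[of H e] wf_digraph.head_in_verts[of H e]
    by (auto simp: subgraph_def th)
  have arc_iff: "(u, w) \<in> arcs H \<longleftrightarrow> (g u, g w) \<in> parcs C4" if "u \<in> verts H" "w \<in> verts H" for u w
  proof
    assume "(u, w) \<in> arcs H"
    then show "(g u, g w) \<in> parcs C4" using iso_arc[of "(u, w)"] arcs(1) by force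
  next
    assume "(g u, g w) \<in> parcs C4"
    then obtain e where e: "e \<in> arcs H" "(g u, g w) = iso_arcs f e" using arcs(1) by blast
    then have "g (fst e) = g u" "g (snd e) = g w" using iso_arc by auto
    then have "fst e = u" "snd e = w"
      using wf[OF e(1)] that by (auto dest: inj_onD[OF inj])
    with e show "(u, w) \<in> arcs H" by (cases e) auto
  qed
  have "\<exists>v \<in> verts H. g v = k" if "k \<in> {0, 1, 2, 3}" for k
    using that unfolding verts[symmetric] by blast
  then obtain a b c d where in_H: "a \<in> verts H" "b \<in> verts H" "c \<in> verts H" "d \<in> verts H"
    and g: "g a = 0" "g b = 1" "g c = 2" "g d = 3"
    by (metis insertCI)
  have all: "w \<in> {a, b, c, d}" if "w \<in> verts H" for w
  proof -
    have "g w \<in> g ` verts H" using that by (rule imageI)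
    then have "g w = g a \<or> g w = g b \<or> g w = g c \<or> g w = g d" by (simp add: verts g)
    then show ?thesis using inj_on_eq_iff[OF inj that] in_H by simp
  qed
  have verts_H: "verts H = {a, b, c, d}"
    using all in_H by (intro equalityI subsetI) auto
  have arcs_G: "(u, w) \<in> parcs G \<longleftrightarrow> w \<in> verts H \<and> (g u, g w) \<in> parcs C4"
    if "u \<in> verts H" for u w
  proof -
    have "(u, w) \<in> parcs G \<longleftrightarrow> (u, w) \<in> arcs H"
      using adjacent_mem_component[OF H that] sub by (auto simp: subgraph_def)
    also have "\<dots> \<longleftrightarrow> w \<in> verts H \<and> (u, w) \<in> arcs H" using wf by force
    finally show ?thesis using arc_iff[OF that] by blast
  qed
  have "distinct [a, b, c, d]" using g by auto
  moreover have "(a, w) \<in> parcs G \<longleftrightarrow> w \<in> {b, d}" "(b, w) \<in> parcs G \<longleftrightarrow> w \<in> {a, c}"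
    "(c, w) \<in> parcs G \<longleftrightarrow> w \<in> {b, d}" "(d, w) \<in> parcs G \<longleftrightarrow> w \<in> {a, c}" for w
    unfolding arcs_G[OF in_H(1)] arcs_G[OF in_H(2)] arcs_G[OF in_H(3)] arcs_G[OF in_H(4)] verts_H
    by (auto simp: C4_def g)
  ultimately have "is_four_cycle a b c d" by (simp add: is_four_cycle_def)
  with that show ?thesis .
qed

text \<open>The component is the subgraph induced by \<open>V\<close>. It is maximal because
  \<open>V\<close> is closed under adjacency, so nothing outside \<open>V\<close> is reachable from
  \<open>a\<close>.\<close>

lemma component_of_four_cycle:
  assumes "is_four_cycle a b c d"
  shows "\<exists>H \<in> connected_components G. digraph_iso H (with_proj C4)"
proof -
  have ne: "distinct [a, b, c, d]"
    and nbrs: "(a, w) \<in> parcs G \<longleftrightarrow> w = b \<or> w = d" "(b, w) \<in> parcs G \<longleftrightarrow> w = a \<or> w = c"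
      "(c, w) \<in> parcs G \<longleftrightarrow> w = b \<or> w = d" "(d, w) \<in> parcs G \<longleftrightarrow> w = a \<or> w = c" for w
    using assms unfolding is_four_cycle_def by auto
  define V where "V = {a, b, c, d}"
  define E where "E = {e \<in> parcs G. fst e \<in> V}"
  define H where "H = with_proj \<lparr>pverts = V, parcs = E\<rparr>"
  have closed: "w \<in> V" if "u \<in> V" "(u, w) \<in> parcs G" for u w
    using that by (auto simp: V_def nbrs)
  have E: "E = {(a,b), (b,a), (b,c), (c,b), (c,d), (d,c), (d,a), (a,d)}"
  proof (rule set_eqI)
    fix e :: "'a \<times> 'a"
    obtain u w where "e = (u, w)" by fastforce
    then show "e \<in> E \<longleftrightarrow> e \<in> {(a,b), (b,a), (b,c), (c,b), (c,d), (d,c), (d,a), (a,d)}"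
      using ne by (cases "u = a"; cases "u = b"; cases "u = c"; cases "u = d")
        (simp_all add: E_def V_def nbrs disj_commute)
  qed
  have VG: "V \<subseteq> pverts G" using E in_arcsD1 unfolding E_def V_def by blast
  have wfH: "wf_digraph H"
    unfolding wf_digraph_def H_def by (auto simp: E V_def)
  have sub: "subgraph H G"
    unfolding subgraph_def compatible_def using VG wfH wf_digraph
    by (auto simp: H_def E_def)
  interpret S: pair_wf_digraph "mk_symmetric H"
    using wfH by (rule wf_digraph.wellformed_mk_symmetric)
  have "parcs (mk_symmetric H) = E" unfolding parcs_mk_symmetric H_def by (auto simp: E)
  then have adj: "(u, v) \<in> parcs (mk_symmetric H)" if "(u, v) \<in> E" for u v using that by simp
  have to_a: "u \<rightarrow>\<^sup>*\<^bsub>mk_symmetric H\<^esub> a" if "u \<in> V" for u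
  proof -
    have ba: "b \<rightarrow>\<^sup>*\<^bsub>mk_symmetric H\<^esub> a" and "d \<rightarrow>\<^sup>*\<^bsub>mk_symmetric H\<^esub> a"
      using adj by (auto simp: E)
    moreover have "c \<rightarrow>\<^sup>*\<^bsub>mk_symmetric H\<^esub> a"
      using S.adj_reachable_trans[OF adj ba] by (simp add: E)
    moreover have "a \<rightarrow>\<^sup>*\<^bsub>mk_symmetric H\<^esub> a"
      by (intro S.reachable_refl) (simp add: H_def V_def)
    ultimately show ?thesis using that by (auto simp: V_def)
  qed
  have from_a: "a \<rightarrow>\<^sup>*\<^bsub>mk_symmetric H\<^esub> u" if "u \<in> V" for u
    using to_a[OF that] symmetric_mk_symmetric by (rule symmetric_reachable[rotated])
  have "Digraph_Component.connected H"
    unfolding Digraph_Component.connected_def strongly_connected_def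
    using S.reachable_trans[OF to_a from_a] by (auto simp: H_def V_def)
  moreover have "H' = H"
    if H': "subgraph H H'" "subgraph H' G" "Digraph_Component.connected H'" for H'
  proof -
    have th: "tail H' = fst" "head H' = snd"
      using H' by (auto simp: subgraph_def compatible_def)
    have arcs: "e \<in> parcs G" if "e \<in> arcs H'" for e
      using H' that by (auto simp: subgraph_def)
    have V_H': "V \<subseteq> verts H'" and E_H': "E \<subseteq> arcs H'"
      using H'(1) by (auto simp: subgraph_def H_def)
    have wfH': "wf_digraph H'" using H' by (simp add: subgraph_def)
    interpret S': pair_wf_digraph "mk_symmetric H'"
      using wfH' by (rule wf_digraph.wellformed_mk_symmetric)
    have "u \<in> V" if "u \<in> verts H'" for u
    proof -
      have "a \<rightarrow>\<^sup>*\<^bsub>mk_symmetric H'\<^esub> u"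
        using H'(3) that V_H'
        by (auto simp: Digraph_Component.connected_def strongly_connected_def V_def)
      then show ?thesis
      proof (induction rule: S'.reachable_induct)
        case base
        show ?case by (simp add: V_def)
      next
        case (step u w)
        then have "(u, w) \<in> parcs G"
          using arcs arcs_symmetric by (fastforce simp: parcs_mk_symmetric th)
        with step closed show ?case by blast
      qed
    qed
    with V_H' have V: "verts H' = V" by blast
    have "e \<in> E" if "e \<in> arcs H'" for e
      using arcs[OF that] wf_digraph.tail_in_verts[OF wfH' that] V th by (simp add: E_def)
    with E_H' have "arcs H' = E" by blast
    with V th show "H' = H" by (simp add: H_def)
  qed
  ultimately have comp: "H \<in> connected_components G"
    using sub by (auto simp: connected_components_def max_subgraph_def)
  \<comment> \<open>The default value 0 is the number of \<open>a\<close>.\<close>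
  define g where "g = (\<lambda>_. 0 :: nat)(b := 1, c := 2, d := 3)"
  have g: "g a = 0" "g b = 1" "g c = 2" "g d = 3" using ne by (auto simp: g_def)
  define f where "f = \<lparr>iso_verts = g, iso_arcs = map_prod g g, iso_head = snd, iso_tail = fst\<rparr>"
  have inj: "inj_on g V" by (auto simp: inj_on_def V_def g)
  have "pre_digraph.digraph_isomorphism H f"
  proof -
    have "E \<subseteq> V \<times> V" by (simp add: E V_def)
    then have "inj_on (map_prod g g) E" by (rule inj_on_subset[OF map_prod_inj_on[OF inj inj]])
    with wfH inj show ?thesis
      by (simp add: pre_digraph.digraph_isomorphism_def f_def H_def)
  qed
  moreover have "with_proj C4 = app_iso f H"
    by (simp add: app_iso_def f_def H_def C4_def with_proj_def E V_def g)
  ultimately show ?thesis using comp unfolding digraph_iso_def by blast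
qed

text \<open>A single vertex of the cycle does not dominate the opposite one, and no vertex outside
  helps, so every dominating set contains at least two of the four.\<close>

lemma fractional_domatic_number_le_two_of_four_cycle:
  assumes "is_four_cycle a b c d"
  shows "fractional_domatic_number G \<le> 2"
proof (rule fractional_domatic_number_le_two[of "{a, b, c, d}" 2])
  have ne: "distinct [a, b, c, d]"
    and nbrs: "(a, w) \<in> parcs G \<longleftrightarrow> w = b \<or> w = d" "(b, w) \<in> parcs G \<longleftrightarrow> w = a \<or> w = c"
      "(c, w) \<in> parcs G \<longleftrightarrow> w = b \<or> w = d" "(d, w) \<in> parcs G \<longleftrightarrow> w = a \<or> w = c" for w
    using assms unfolding is_four_cycle_def by auto
  show V: "{a, b, c, d} \<subseteq> pverts G" using nbrs in_arcsD1 by blast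
  show "card {a, b, c, d} = 2 * 2" using ne by simp
  fix D assume "dominating_set G D"
  then have dom: "v \<in> D \<or> (\<exists>u \<in> D. (v, u) \<in> parcs G)" if "v \<in> {a, b, c, d}" for v
    using V that unfolding dominating_set_def by auto
  have "a \<in> D \<or> b \<in> D \<or> d \<in> D" "b \<in> D \<or> a \<in> D \<or> c \<in> D"
    "c \<in> D \<or> b \<in> D \<or> d \<in> D" "d \<in> D \<or> a \<in> D \<or> c \<in> D"
    using dom[of a] dom[of b] dom[of c] dom[of d] by (auto simp: nbrs)
  then have "\<exists>x y. x \<noteq> y \<and> {x, y} \<subseteq> D \<inter> {a, b, c, d}" using ne by auto
  then obtain x y where xy: "x \<noteq> y" "{x, y} \<subseteq> D \<inter> {a, b, c, d}" by blast
  have "card {x, y} \<le> card (D \<inter> {a, b, c, d})" using xy(2) by (intro card_mono) auto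
  with xy(1) show "2 \<le> card (D \<inter> {a, b, c, d})" by simp
qed simp

end

section \<open>Combining the bounds with the structure around non-slack vertices\<close>

theorem theorem1:
  fixes G :: "'a pair_pre_digraph"
  assumes "pair_graph G"
    and "\<forall>v \<in> pverts G. out_degree (with_proj G) v \<noteq> 0"
  shows "fractional_domatic_number (with_proj G) = 2 \<longleftrightarrow>
           (\<exists>v \<in> pverts G. out_degree (with_proj G) v = 1) \<or>
           (\<exists>H \<in> connected_components (with_proj G). digraph_iso H (with_proj C4))"
proof -
  interpret pair_graph G by fact
  have nbr: "\<exists>w. (v, w) \<in> parcs G" if "v \<in> pverts G" for v
    using assms(2) that by (metis card.empty empty_Collect_eq out_degree_eq_card)
  then have ge: "2 \<le> fractional_domatic_number G"
    using in_arcsD2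
    by (intro fractional_domatic_number_ge_two) (unfold no_isolated_def, blast)
  show ?thesis
  proof
    assume FD: "fractional_domatic_number G = 2"
    show "(\<exists>v \<in> pverts G. out_degree G v = 1) \<or>
      (\<exists>H \<in> connected_components G. digraph_iso H (with_proj C4))"
    proof (cases "\<exists>v \<in> pverts G. out_degree G v = 1")
      case no_leaf: False
      have two: "\<exists>a b. a \<noteq> b \<and> (v, a) \<in> parcs G \<and> (v, b) \<in> parcs G" if v: "v \<in> pverts G" for v
      proof -
        obtain a where a: "(v, a) \<in> parcs G" using nbr v by blast
        have "{w. (v, w) \<in> parcs G} \<noteq> {a}"
          using no_leaf v by (auto simp: out_degree_eq_card)
        with a show ?thesis by blast
      qed
      interpret min_degree_two G by unfold_locales (rule two)
      \<comment> \<open>If all vertices were slack, the value would exceed 2.\<close>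
      obtain x where "x \<in> pverts G" "\<not> slack_at x"
        using fractional_domatic_number_gt_two FD by fastforce
      then obtain y i z where "is_four_cycle x y i z" by (rule four_cycle_of_not_slack_at)
      then show ?thesis using component_of_four_cycle by blast
    qed blast
  next
    assume "(\<exists>v \<in> pverts G. out_degree G v = 1) \<or>
      (\<exists>H \<in> connected_components G. digraph_iso H (with_proj C4))"
    then have "fractional_domatic_number G \<le> 2"
      using fractional_domatic_number_le_two_of_leaf fractional_domatic_number_le_two_of_four_cycle
        four_cycle_of_component by metis
    with ge show "fractional_domatic_number G = 2" by (rule antisym[rotated])
  qed
qed

end
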